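(* Assume there exists a completely separable MAD family of subsets of $\omega$. Then for every $T\in\mathsf{T}^*$ there is a surjective interior map $f$ from $\beta\omega$ onto $T$.
   Context: $\beta\omega$ is the Čech–Stone compactification of the discrete space $\omega$, identified with the space of ultrafilters on $\omega$ with basic clopen sets $\hat A=\{\mathcal U:A\in\mathcal U\}$ for $A\subseteq\omega$. An almost disjoint (AD) family is a family $\mathcal A\subseteq[\omega]^\omega$ with $|A\cap B|<\omega$ for distinct $A,B\in\mathcal A$; a MAD family is an infinite AD family maximal with respect to inclusion. For an AD family $\mathcal A$, $\mathcal I(\mathcal A)$ is the ideal on $\omega$ generated by $\mathcal A$ together with all finite sets. $\mathcal A$ is completely separable if for every $X\subseteq\omega$ with $X\notin\mathcal I(\mathcal A)$, either $X$ is almost disjoint from every element of $\mathcal A$, or there is $A\in\mathcal A$ with $A\subseteq^* X$ (i.e. $A\setminus X$ finite). $\mathsf{T}^*$ denotes the class of all finite trees with an additional top element (above all nodes), each regarded as a topological space whose open sets are the upward closed sets. An interior map is a map that is continuous and open. *)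

theory Defs
  imports "HOL-Analysis.Analysis"
begin

definition ultrafilter_on_omega :: "nat set set \<Rightarrow> bool" where
  "ultrafilter_on_omega \<U> \<longleftrightarrow>
     UNIV \<in> \<U> \<and> {} \<notin> \<U> \<and>
     (\<forall>A B. A \<in> \<U> \<longrightarrow> A \<subseteq> B \<longrightarrow> B \<in> \<U>) \<and>
     (\<forall>A B. A \<in> \<U> \<longrightarrow> B \<in> \<U> \<longrightarrow> A \<inter> B \<in> \<U>) \<and>
     (\<forall>A. A \<in> \<U> \<or> - A \<in> \<U>)"

definition hat :: "nat set \<Rightarrow> nat set set set" where
  "hat A = {\<U>. ultrafilter_on_omega \<U> \<and> A \<in> \<U>}"

definition beta_omega :: "nat set set topology" where
  "beta_omega = topology_generated_by (range hat)"

lemma topspace_beta_omega: "topspace beta_omega = {\<U>. ultrafilter_on_omega \<U>}"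
  unfolding beta_omega_def by (auto simp: hat_def ultrafilter_on_omega_def)

lemma hat_Int: "hat (A \<inter> B) = hat A \<inter> hat B"
  by (auto simp: hat_def ultrafilter_on_omega_def)

lemma openin_beta_omega_iff:
  "openin beta_omega U \<longleftrightarrow>
     (\<forall>\<U>\<in>U. \<exists>A. \<U> \<in> hat A \<and> hat A \<subseteq> U)" (is "_ \<longleftrightarrow> ?R U")
proof
  assume "openin beta_omega U"
  then have "generate_topology_on (range hat) U"
    by (simp add: beta_omega_def openin_topology_generated_by_iff)
  then show "?R U"
  proof induction
    case (Int a b)
    show ?case
    proof
      fix \<U> assume "\<U> \<in> a \<inter> b"
      then obtain A B where "\<U> \<in> hat A" "hat A \<subseteq> a" "\<U> \<in> hat B" "hat B \<subseteq> b"
        using Int.IH by blast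
      then have "\<U> \<in> hat (A \<inter> B) \<and> hat (A \<inter> B) \<subseteq> a \<inter> b"
        by (auto simp: hat_Int)
      then show "\<exists>A. \<U> \<in> hat A \<and> hat A \<subseteq> a \<inter> b" ..
    qed
  next
    case (UN K)
    then show ?case by (meson Union_iff Union_upper subset_trans)
  qed auto
next
  assume R: "?R U"
  have "openin beta_omega (hat A)" for A
    unfolding beta_omega_def by (rule topology_generated_by_Basis) simp
  then show "openin beta_omega U"
    using R by (subst openin_subopen) blast
qed

definition ad_family :: "nat set set \<Rightarrow> bool" where
  "ad_family \<A> \<longleftrightarrow>
     (\<forall>A\<in>\<A>. infinite A) \<and> (\<forall>A\<in>\<A>. \<forall>B\<in>\<A>. A \<noteq> B \<longrightarrow> finite (A \<inter> B))"

definition mad_family :: "nat set set \<Rightarrow> bool" where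
  "mad_family \<A> \<longleftrightarrow>
     ad_family \<A> \<and> infinite \<A> \<and> (\<forall>\<B>. ad_family \<B> \<longrightarrow> \<A> \<subseteq> \<B> \<longrightarrow> \<B> = \<A>)"

definition set_ideal :: "nat set set \<Rightarrow> bool" where
  "set_ideal \<I> \<longleftrightarrow>
     {} \<in> \<I> \<and>
     (\<forall>A B. A \<in> \<I> \<longrightarrow> B \<subseteq> A \<longrightarrow> B \<in> \<I>) \<and>
     (\<forall>A B. A \<in> \<I> \<longrightarrow> B \<in> \<I> \<longrightarrow> A \<union> B \<in> \<I>)"

definition ad_ideal :: "nat set set \<Rightarrow> nat set set" where
  "ad_ideal \<A> = set_ideal hull (\<A> \<union> {F. finite F})"

definition completely_separable :: "nat set set \<Rightarrow> bool" where
  "completely_separable \<A> \<longleftrightarrow>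
     (\<forall>X. X \<notin> ad_ideal \<A> \<longrightarrow>
        (\<forall>A\<in>\<A>. finite (A \<inter> X)) \<or> (\<exists>A\<in>\<A>. finite (A - X)))"

text \<open>Posets are given by a carrier \<open>P\<close> and a relation \<open>r\<close>, where \<open>(x, y) \<in> r\<close> means
  \<open>x \<le> y\<close>. Trees are rooted, hence nonempty, and grow upwards from the root.\<close>

definition finite_tree :: "'a set \<Rightarrow> 'a rel \<Rightarrow> bool" where
  "finite_tree P r \<longleftrightarrow>
     finite P \<and> partial_order_on P r \<and>
     (\<exists>root\<in>P. \<forall>x\<in>P. (root, x) \<in> r) \<and>
     (\<forall>x\<in>P. total_on {y\<in>P. (y, x) \<in> r} r)"

definition tree_with_top :: "'a set \<Rightarrow> 'a rel \<Rightarrow> bool" where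
  "tree_with_top P r \<longleftrightarrow>
     partial_order_on P r \<and>
     (\<exists>t\<in>P. (\<forall>x\<in>P. (x, t) \<in> r) \<and> finite_tree (P - {t}) (Restr r (P - {t})))"

definition upset_topology :: "'a set \<Rightarrow> 'a rel \<Rightarrow> 'a topology" where
  "upset_topology P r = topology (\<lambda>U. U \<subseteq> P \<and> (\<forall>x\<in>U. \<forall>y\<in>P. (x, y) \<in> r \<longrightarrow> y \<in> U))"

lemma openin_upset_topology:
  "openin (upset_topology P r) U \<longleftrightarrow>
     U \<subseteq> P \<and> (\<forall>x\<in>U. \<forall>y\<in>P. (x, y) \<in> r \<longrightarrow> y \<in> U)"
proof -
  have "istopology (\<lambda>U. U \<subseteq> P \<and> (\<forall>x\<in>U. \<forall>y\<in>P. (x, y) \<in> r \<longrightarrow> y \<in> U))"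
    unfolding istopology_def by blast
  then show ?thesis by (simp add: upset_topology_def)
qed

lemma topspace_upset_topology: "topspace (upset_topology P r) = P"
  unfolding topspace_def openin_upset_topology by blast

definition interior_map :: "'a topology \<Rightarrow> 'b topology \<Rightarrow> ('a \<Rightarrow> 'b) \<Rightarrow> bool" where
  "interior_map X Y f \<longleftrightarrow> continuous_map X Y f \<and> open_map X Y f"

end

theory Submission
  imports Defs
begin

text \<open>Nonprincipal ultrafilters are mapped into the tree, principal ones to the top. For a node
  \<open>x\<close>, a map from the remainder of \<open>\<omega>\<close> onto the nodes above \<open>x\<close> is built by induction from the
  top of the tree downwards. Every member \<open>A\<close> of the completely separable MAD family is split
  into infinite pieces, one for each node \<open>z\<close> strictly above \<open>x\<close>; the remainder of the piece
  belonging to \<open>z\<close> is mapped onto the nodes above \<open>z\<close> by the induction hypothesis, and the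
  ultrafilters containing no member of the family go to \<open>x\<close>. If such an ultrafilter contains \<open>X\<close>,
  then \<open>X\<close> is not in the ideal of the family, so \<open>X\<close> almost contains a whole member and with it
  one piece for every node strictly above \<open>x\<close>, which makes the map open.\<close>

subsection \<open>Ultrafilters and ideals\<close>

lemma ultrafilter_on_omegaD:
  assumes "ultrafilter_on_omega U"
  shows "UNIV \<in> U" "{} \<notin> U" "\<And>A B. A \<in> U \<Longrightarrow> A \<subseteq> B \<Longrightarrow> B \<in> U"
    "\<And>A B. A \<in> U \<Longrightarrow> B \<in> U \<Longrightarrow> A \<inter> B \<in> U" "\<And>A. A \<notin> U \<Longrightarrow> - A \<in> U"
  using assms unfolding ultrafilter_on_omega_def by blast+

text \<open>Primeness for finite unions: if \<open>A\<close> is not in \<open>U\<close>,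
  intersecting with \<open>- A\<close> leaves the union of the remaining sets in
  \<open>U\<close>.\<close>

lemma ultrafilter_on_omega_Union:
  assumes "ultrafilter_on_omega U" "finite \<F>" "\<Union>\<F> \<in> U"
  shows "\<exists>A\<in>\<F>. A \<in> U"
  using assms(2,3)
proof (induction \<F>)
  case empty
  then show ?case using ultrafilter_on_omegaD(2)[OF assms(1)] by simp
next
  case (insert A \<F>)
  show ?case
  proof (cases "A \<in> U")
    case False
    then have "- A \<inter> \<Union>(insert A \<F>) \<in> U"
      using ultrafilter_on_omegaD(4,5)[OF assms(1)] insert.prems by blast
    then have "\<Union>\<F> \<in> U"
      by (rule ultrafilter_on_omegaD(3)[OF assms(1)]) blast
    then show ?thesis using insert.IH by blast
  qed blast
qed

lemma ultrafilter_on_omega_principal: "ultrafilter_on_omega {A. n \<in> A}"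
  unfolding ultrafilter_on_omega_def by blast

lemma set_idealD:
  assumes "set_ideal I"
  shows "{} \<in> I" "\<And>A B. A \<in> I \<Longrightarrow> B \<subseteq> A \<Longrightarrow> B \<in> I" "\<And>A B. A \<in> I \<Longrightarrow> B \<in> I \<Longrightarrow> A \<union> B \<in> I"
  using assms unfolding set_ideal_def by blast+

text \<open>Zorn's lemma gives a maximal proper ideal above \<open>I\<close>. It is prime, so the
  sets outside it form an ultrafilter.\<close>

lemma ultrafilter_avoiding_ideal:
  assumes "set_ideal I" "UNIV \<notin> I"
  shows "\<exists>U. ultrafilter_on_omega U \<and> U \<inter> I = {}"
proof -
  let ?S = "{J. set_ideal J \<and> I \<subseteq> J \<and> UNIV \<notin> J}"
  have "\<exists>M\<in>?S. \<forall>J\<in>?S. M \<subseteq> J \<longrightarrow> J = M"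
  proof (rule subset_Zorn_nonempty)
    show "?S \<noteq> {}" using assms by blast
  next
    fix \<C> assume ne: "\<C> \<noteq> {}" and ch: "subset.chain ?S \<C>"
    then have sub: "\<C> \<subseteq> ?S" and tot: "\<And>J K. J \<in> \<C> \<Longrightarrow> K \<in> \<C> \<Longrightarrow> J \<subseteq> K \<or> K \<subseteq> J"
      by (auto simp: subset_chain_def)
    have "A \<union> B \<in> \<Union>\<C>" if "A \<in> \<Union>\<C>" "B \<in> \<Union>\<C>" for A B
    proof -
      obtain J K where JK: "J \<in> \<C>" "A \<in> J" "K \<in> \<C>" "B \<in> K" using \<open>A \<in> \<Union>\<C>\<close> \<open>B \<in> \<Union>\<C>\<close> by blast
      then obtain L where "L \<in> \<C>" "A \<in> L" "B \<in> L" using tot by blast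
      then show ?thesis using sub set_idealD(3) by blast
    qed
    moreover have "{} \<in> \<Union>\<C>" using ne sub set_idealD(1) by blast
    moreover have "B \<in> \<Union>\<C>" if "A \<in> \<Union>\<C>" "B \<subseteq> A" for A B
      using that sub set_idealD(2) by blast
    ultimately have "set_ideal (\<Union>\<C>)" unfolding set_ideal_def by blast
    then show "\<Union>\<C> \<in> ?S" using ne sub by blast
  qed
  then obtain M where "M \<in> ?S" and M_max: "\<forall>J\<in>?S. M \<subseteq> J \<longrightarrow> J = M" ..
  then have M: "set_ideal M" "I \<subseteq> M" "UNIV \<notin> M" by simp_all
  have max: "J = M" if "set_ideal J" "I \<subseteq> J" "UNIV \<notin> J" "M \<subseteq> J" for J
    using M_max that by simp
  have prime: "- X \<in> M" if "X \<notin> M" for X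
  proof -
    \<comment> \<open>The ideal generated by \<open>M\<close> and \<open>X\<close>. It contains
      \<open>X\<close>, so it differs from \<open>M\<close>, and maximality forces it to be
      improper.\<close>
    define J where "J = {Y. \<exists>m\<in>M. Y \<subseteq> m \<union> X}"
    have J: "Y \<in> J \<longleftrightarrow> (\<exists>m\<in>M. Y \<subseteq> m \<union> X)" for Y by (simp add: J_def)
    have "set_ideal J"
      unfolding set_ideal_def
    proof (intro conjI allI impI)
      show "{} \<in> J" using set_idealD(1)[OF M(1)] J by blast
    next
      fix A B assume "A \<in> J" "B \<subseteq> A"
      then show "B \<in> J" using J by (meson order_trans)
    next
      fix A B assume "A \<in> J" "B \<in> J"
      then obtain m n where mn: "m \<in> M" "n \<in> M" "A \<subseteq> m \<union> X" "B \<subseteq> n \<union> X"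
        unfolding J by blast
      then have "A \<union> B \<subseteq> (m \<union> n) \<union> X" by blast
      then show "A \<union> B \<in> J" unfolding J
        using set_idealD(3)[OF M(1) mn(1,2)] by (rule rev_bexI[rotated])
    qed
    moreover have "M \<subseteq> J" unfolding J_def by blast
    moreover have "X \<in> J" unfolding J using set_idealD(1)[OF M(1)] by blast
    ultimately have "UNIV \<in> J" using max[of J] M(2) that by blast
    then obtain m where "m \<in> M" "UNIV \<subseteq> m \<union> X" unfolding J ..
    then have "m \<in> M" "- X \<subseteq> m" by auto
    then show ?thesis using set_idealD(2)[OF M(1)] by blast
  qed
  have nM: "X \<in> M \<Longrightarrow> - X \<notin> M" for X
    using set_idealD(3)[OF M(1), of X "- X"] M(3) by auto
  have "ultrafilter_on_omega (- M)"
    unfolding ultrafilter_on_omega_def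
  proof (intro conjI allI impI)
    fix A B assume "A \<in> - M" "B \<in> - M"
    then have "- (A \<inter> B) \<in> M" using prime set_idealD(3)[OF M(1), of "- A" "- B"] by auto
    then show "A \<inter> B \<in> - M" using nM[of "A \<inter> B"] by blast
  next
    fix A show "A \<in> - M \<or> - A \<in> - M" using nM by blast
  qed (use M set_idealD[OF M(1)] in blast)+
  then show ?thesis using M(2) by blast
qed

section \<open>The ideal generated by an almost disjoint family\<close>

lemma set_ideal_ad_ideal: "set_ideal (ad_ideal \<A>)"
  unfolding ad_ideal_def
  by (rule hull_in) (unfold set_ideal_def, blast)

text \<open>Makes the hull explicit: the sets almost covered by finitely many members form an ideal
  containing the generators, and every ideal containing the generators contains these sets.\<close>

lemma ad_ideal_iff: "X \<in> ad_ideal \<A> \<longleftrightarrow> (\<exists>\<F>\<subseteq>\<A>. finite \<F> \<and> finite (X - \<Union>\<F>))"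
proof
  let ?J = "{X. \<exists>\<F>\<subseteq>\<A>. finite \<F> \<and> finite (X - \<Union>\<F>)}"
  have "set_ideal ?J"
    unfolding set_ideal_def
  proof (intro conjI allI impI)
    show "{} \<in> ?J" by auto
  next
    fix A B assume "A \<in> ?J" "B \<subseteq> A"
    then show "B \<in> ?J" by (blast intro: finite_subset[of "B - _" "A - _"])
  next
    fix A B assume "A \<in> ?J" "B \<in> ?J"
    then obtain \<F> \<G> where FG: "\<F> \<subseteq> \<A>" "\<G> \<subseteq> \<A>" "finite \<F>" "finite \<G>"
      "finite (A - \<Union>\<F>)" "finite (B - \<Union>\<G>)" by blast
    have "finite ((A \<union> B) - \<Union>(\<F> \<union> \<G>))"
      by (rule finite_subset[of _ "(A - \<Union>\<F>) \<union> (B - \<Union>\<G>)"]) (use FG in auto)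
    then show "A \<union> B \<in> ?J" using FG by (intro CollectI exI[of _ "\<F> \<union> \<G>"]) simp
  qed
  moreover have "\<A> \<union> {F. finite F} \<subseteq> ?J"
  proof
    fix X assume X: "X \<in> \<A> \<union> {F. finite F}"
    show "X \<in> ?J"
    proof (cases "finite X")
      case False
      then show ?thesis using X by (intro CollectI exI[of _ "{X}"]) simp
    qed auto
  qed
  ultimately have "ad_ideal \<A> \<subseteq> ?J" unfolding ad_ideal_def by (simp add: hull_minimal)
  then show "X \<in> ad_ideal \<A> \<Longrightarrow> \<exists>\<F>\<subseteq>\<A>. finite \<F> \<and> finite (X - \<Union>\<F>)" by blast
next
  assume "\<exists>\<F>\<subseteq>\<A>. finite \<F> \<and> finite (X - \<Union>\<F>)"
  then obtain \<F> where F: "\<F> \<subseteq> \<A>" "finite \<F>" "finite (X - \<Union>\<F>)" by blast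
  have gen: "\<A> \<union> {F. finite F} \<subseteq> ad_ideal \<A>" unfolding ad_ideal_def by (rule hull_subset)
  from F(2,1) have "\<Union>\<F> \<in> ad_ideal \<A>"
  proof (induction \<F>)
    case (insert A \<F>)
    then have "A \<union> \<Union>\<F> \<in> ad_ideal \<A>"
      using gen by (intro set_idealD(3)[OF set_ideal_ad_ideal]) auto
    then show ?case by simp
  qed (use gen in auto)
  then have "(X - \<Union>\<F>) \<union> \<Union>\<F> \<in> ad_ideal \<A>"
    using gen F(3) by (intro set_idealD(3)[OF set_ideal_ad_ideal]) auto
  then show "X \<in> ad_ideal \<A>" by (rule set_idealD(2)[OF set_ideal_ad_ideal]) blast
qed

text \<open>If finitely many members almost covered \<omega>, any further member would be covered by
  finitely many finite intersections and a finite set, hence would be finite.\<close>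

lemma UNIV_notin_ad_ideal:
  assumes "ad_family \<A>" "infinite \<A>"
  shows "UNIV \<notin> ad_ideal \<A>"
proof
  assume "UNIV \<in> ad_ideal \<A>"
  then obtain \<F> where F: "\<F> \<subseteq> \<A>" "finite \<F>" "finite (- \<Union>\<F>)"
    by (auto simp: ad_ideal_iff Compl_eq_Diff_UNIV)
  have "\<not> \<A> \<subseteq> \<F>" using assms(2) F(2) by (metis finite_subset)
  then obtain A where A: "A \<in> \<A>" "A \<notin> \<F>" by blast
  have "finite (\<Union>B\<in>\<F>. A \<inter> B)"
    using F A assms(1) unfolding ad_family_def
    by (intro finite_UN_I) (simp, metis subsetD)
  then have "finite ((\<Union>B\<in>\<F>. A \<inter> B) \<union> - \<Union>\<F>)" using F(3) by simp
  then have "finite A" by (rule rev_finite_subset) blast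
  then show False using A(1) assms(1) by (simp add: ad_family_def)
qed

text \<open>Maximality excludes the other alternative of complete separability: an infinite set
  almost disjoint from every member would already be a member, hence in the ideal.\<close>

lemma completely_separable_mad_almost_contains:
  assumes "mad_family \<A>" "completely_separable \<A>" "X \<notin> ad_ideal \<A>"
  shows "\<exists>A\<in>\<A>. finite (A - X)"
proof (rule ccontr)
  assume "\<not> ?thesis"
  then have ad: "\<forall>A\<in>\<A>. finite (A \<inter> X)"
    using assms(2,3) unfolding completely_separable_def by blast
  have gen: "\<A> \<union> {F. finite F} \<subseteq> ad_ideal \<A>" unfolding ad_ideal_def by (rule hull_subset)
  then have "infinite X" using assms(3) by blast
  with ad have "ad_family (insert X \<A>)"
    using assms(1) unfolding mad_family_def ad_family_def by (simp add: Int_commute)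
  then have "insert X \<A> = \<A>" using assms(1) unfolding mad_family_def by blast
  then show False using gen assms(3) by blast
qed

subsection \<open>Remainders of sets of natural numbers\<close>

text \<open>The remainder of \<open>A\<close> in \<beta>\<omega>. An ultrafilter with a finite
  member is principal, so demanding infinite members removes exactly the principal
  ultrafilters.\<close>

definition free_ultrafilters :: "nat set \<Rightarrow> nat set set set" where
  "free_ultrafilters A = {U. ultrafilter_on_omega U \<and> A \<in> U \<and> (\<forall>F\<in>U. infinite F)}"

text \<open>Free ultrafilters contain no finite set, so they respect inclusion modulo finite
  sets.\<close>

lemma free_ultrafilters_almost_subset:
  assumes "U \<in> free_ultrafilters C" "A \<in> U" "finite (A - B)"
  shows "B \<in> U"
proof -
  have U: "ultrafilter_on_omega U" using assms(1) by (simp add: free_ultrafilters_def)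
  have "A - B \<notin> U" using assms(1,3) by (auto simp: free_ultrafilters_def)
  then have "- (A - B) \<inter> A \<in> U" using ultrafilter_on_omegaD(4,5)[OF U] assms(2) by blast
  then show ?thesis by (rule ultrafilter_on_omegaD(3)[OF U]) blast
qed

text \<open>This says that \<open>f\<close> is interior from the remainder of \<open>A\<close> onto the nodes of \<open>P\<close> above \<open>x\<close>, by
  means of basic neighbourhoods; surjectivity follows from openness once \<open>x\<close> is attained.\<close>

definition interior_onto_cone ::
    "'a set \<Rightarrow> 'a rel \<Rightarrow> 'a \<Rightarrow> nat set \<Rightarrow> (nat set set \<Rightarrow> 'a) \<Rightarrow> bool" where
  "interior_onto_cone P r x A f \<longleftrightarrow>
     (\<forall>U\<in>free_ultrafilters A. f U \<in> P \<and> (x, f U) \<in> r) \<and>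
     (\<forall>U\<in>free_ultrafilters A. \<exists>B\<in>U. \<forall>V\<in>free_ultrafilters A. B \<in> V \<longrightarrow> (f U, f V) \<in> r) \<and>
     (\<forall>U\<in>free_ultrafilters A. \<forall>B\<in>U. \<forall>y\<in>P. (f U, y) \<in> r \<longrightarrow>
        (\<exists>V\<in>free_ultrafilters A. B \<in> V \<and> f V = y)) \<and>
     (\<exists>U\<in>free_ultrafilters A. f U = x)"

lemma interior_onto_coneD:
  assumes "interior_onto_cone P r x A f"
  shows "\<And>U. U \<in> free_ultrafilters A \<Longrightarrow> f U \<in> P"
    "\<And>U. U \<in> free_ultrafilters A \<Longrightarrow> (x, f U) \<in> r"
    "\<And>U. U \<in> free_ultrafilters A \<Longrightarrow>
       \<exists>B\<in>U. \<forall>V\<in>free_ultrafilters A. B \<in> V \<longrightarrow> (f U, f V) \<in> r"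
    "\<And>U B y. U \<in> free_ultrafilters A \<Longrightarrow> B \<in> U \<Longrightarrow> y \<in> P \<Longrightarrow> (f U, y) \<in> r \<Longrightarrow>
       \<exists>V\<in>free_ultrafilters A. B \<in> V \<and> f V = y"
    "\<exists>U\<in>free_ultrafilters A. f U = x"
  using assms unfolding interior_onto_cone_def by blast+

section \<open>Transport along an enumeration\<close>

lemma free_ultrafilters_vimage:
  assumes "inj h" "V \<in> free_ultrafilters UNIV"
  shows "{C. h -` C \<in> V} \<in> free_ultrafilters (range h)"
proof -
  have V: "ultrafilter_on_omega V" using assms(2) by (simp add: free_ultrafilters_def)
  have "ultrafilter_on_omega {C. h -` C \<in> V}"
    using V unfolding ultrafilter_on_omega_def
    by (simp add: vimage_Compl) (meson vimage_mono)
  moreover have "h -` range h = UNIV" by auto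
  then have "h -` range h \<in> V" using ultrafilter_on_omegaD(1)[OF V] by metis
  moreover have "infinite F" if "h -` F \<in> V" for F
    using that assms finite_vimageI[of F h] by (auto simp: free_ultrafilters_def)
  ultimately show ?thesis by (simp add: free_ultrafilters_def)
qed

lemma free_ultrafilters_image:
  assumes "inj h" "U \<in> free_ultrafilters (range h)"
  shows "{B. h ` B \<in> U} \<in> free_ultrafilters UNIV"
proof -
  have U: "ultrafilter_on_omega U" and R: "range h \<in> U"
    using assms(2) by (simp_all add: free_ultrafilters_def)
  have "ultrafilter_on_omega {B. h ` B \<in> U}"
    unfolding ultrafilter_on_omega_def
  proof (intro conjI allI impI)
    fix A B assume "A \<in> {B. h ` B \<in> U}" "A \<subseteq> B"
    then show "B \<in> {B. h ` B \<in> U}" using ultrafilter_on_omegaD(3)[OF U, of "h ` A" "h ` B"] by auto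
  next
    fix A B assume "A \<in> {B. h ` B \<in> U}" "B \<in> {B. h ` B \<in> U}"
    then show "A \<inter> B \<in> {B. h ` B \<in> U}"
      using ultrafilter_on_omegaD(4)[OF U] assms(1) by (simp add: image_Int)
  next
    fix A
    have "h ` (- A) \<in> U" if "h ` A \<notin> U"
    proof -
      have "- (h ` A) \<inter> range h \<in> U" using that R ultrafilter_on_omegaD(4,5)[OF U] by blast
      then show ?thesis by (rule ultrafilter_on_omegaD(3)[OF U]) blast
    qed
    then show "A \<in> {B. h ` B \<in> U} \<or> - A \<in> {B. h ` B \<in> U}" by blast
  qed (use R ultrafilter_on_omegaD(2)[OF U] in auto)
  moreover have "infinite F" if "h ` F \<in> U" for F
    using that assms(2) by (auto simp: free_ultrafilters_def)
  ultimately show ?thesis using R by (simp add: free_ultrafilters_def)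
qed

text \<open>An enumeration of \<open>A\<close> identifies the remainder of \<omega> with that of
  \<open>A\<close>; composing \<open>f\<close> with this identification keeps all four
  properties.\<close>

lemma interior_onto_cone_transfer:
  assumes f: "interior_onto_cone P r x UNIV f" and "infinite A"
  shows "\<exists>g. interior_onto_cone P r x A g"
proof -
  define h where "h = enumerate A"
  have inj: "inj h" and A: "A = range h"
    using bij_enumerate[OF \<open>infinite A\<close>] by (auto simp: bij_betw_def h_def)
  \<comment> \<open>\<open>\<phi>\<close> pulls an ultrafilter on \<open>A\<close> back to \<omega>,
    and \<open>\<psi>\<close> pushes one on \<omega> forward along \<open>h\<close>.\<close>
  define \<phi> where "\<phi> = (\<lambda>U. {B. h ` B \<in> U})"
  define \<psi> where "\<psi> = (\<lambda>V. {C. h -` C \<in> V})"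
  have \<phi>: "\<phi> U \<in> free_ultrafilters UNIV" if "U \<in> free_ultrafilters A" for U
    using free_ultrafilters_image inj that by (simp add: A \<phi>_def)
  have \<psi>: "\<psi> V \<in> free_ultrafilters A" if "V \<in> free_ultrafilters UNIV" for V
    using free_ultrafilters_vimage inj that by (simp add: A \<psi>_def)
  have \<phi>\<psi>: "\<phi> (\<psi> V) = V" for V
    using inj by (simp add: \<phi>_def \<psi>_def inj_vimage_image_eq)
  \<comment> \<open>The image under \<open>h\<close> of the preimage of \<open>B\<close> is
    \<open>B \<inter> range h\<close>, which lies in \<open>U\<close> because \<open>range h\<close>
    is \<open>A\<close>.\<close>
  have vim: "h -` B \<in> \<phi> U" if "U \<in> free_ultrafilters A" "B \<in> U" for U B
    using that ultrafilter_on_omegaD(4)[of U B "range h"]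
    by (simp add: \<phi>_def A free_ultrafilters_def image_vimage_eq)
  have "interior_onto_cone P r x A (\<lambda>U. f (\<phi> U))"
    unfolding interior_onto_cone_def
  proof (intro conjI ballI impI)
    fix U assume "U \<in> free_ultrafilters A"
    then show "f (\<phi> U) \<in> P" "(x, f (\<phi> U)) \<in> r" using interior_onto_coneD(1,2)[OF f] \<phi> by blast+
  next
    fix U assume "U \<in> free_ultrafilters A"
    then obtain B where "B \<in> \<phi> U" "\<forall>V\<in>free_ultrafilters UNIV. B \<in> V \<longrightarrow> (f (\<phi> U), f V) \<in> r"
      using interior_onto_coneD(3)[OF f] \<phi> by blast
    then show "\<exists>B\<in>U. \<forall>V\<in>free_ultrafilters A. B \<in> V \<longrightarrow> (f (\<phi> U), f (\<phi> V)) \<in> r"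
      using \<phi> by (intro bexI[of _ "h ` B"]) (auto simp: \<phi>_def)
  next
    fix U B y
    assume U: "U \<in> free_ultrafilters A" "B \<in> U" "y \<in> P" "(f (\<phi> U), y) \<in> r"
    then obtain V where "V \<in> free_ultrafilters UNIV" "h -` B \<in> V" "f V = y"
      using interior_onto_coneD(4)[OF f \<phi>[OF U(1)] vim[OF U(1,2)]] by blast
    then show "\<exists>V\<in>free_ultrafilters A. B \<in> V \<and> f (\<phi> V) = y"
      using \<psi> by (intro bexI[of _ "\<psi> V"]) (auto simp: \<phi>\<psi>, auto simp: \<psi>_def)
  next
    show "\<exists>U\<in>free_ultrafilters A. f (\<phi> U) = x"
      using interior_onto_coneD(5)[OF f] \<psi> \<phi>\<psi> by metis
  qed
  then show ?thesis by blast
qed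

subsection \<open>Construction of the map\<close>

text \<open>Splits \<open>A\<close> by labels: disjoint infinite subsets of \<open>A\<close> receive
  different labels from \<open>Z\<close>. All other numbers get the default label \<open>z0\<close>,
  so for nonempty \<open>Z\<close> the pieces cover \<open>A\<close>.\<close>

lemma infinite_pieces:
  fixes A :: "nat set"
  assumes "infinite A" "finite Z"
  shows "\<exists>g. (\<forall>z\<in>Z. infinite {n\<in>A. g n = z}) \<and> (Z \<noteq> {} \<longrightarrow> (\<forall>n. g n \<in> Z))"
proof (cases "Z = {}")
  case False
  obtain C :: "nat \<Rightarrow> nat set" where C: "pairwise (\<lambda>i j. disjnt (C i) (C j)) UNIV"
    "(\<Union>i. C i) \<subseteq> A" "\<And>i. infinite (C i)"
    using infinite_infinite_partition[OF assms(1)] by metis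
  obtain e :: "_ \<Rightarrow> nat" where e: "inj_on e Z"
    using finite_imp_inj_to_nat_seg[OF assms(2)] by blast
  obtain z0 where z0: "z0 \<in> Z" using False by blast
  define g where "g n = (if \<exists>z\<in>Z. n \<in> C (e z) then SOME z. z \<in> Z \<and> n \<in> C (e z) else z0)" for n
  have g_eq: "g n = z" if "z \<in> Z" "n \<in> C (e z)" for n z
  proof -
    have "z' = z" if "z' \<in> Z" "n \<in> C (e z')" for z'
      using that \<open>z \<in> Z\<close> \<open>n \<in> C (e z)\<close> C(1) e
      unfolding pairwise_def disjnt_def by (metis UNIV_I disjoint_iff inj_onD)
    then have "(SOME z. z \<in> Z \<and> n \<in> C (e z)) = z" using that by (intro some_equality) blast+
    then show ?thesis using that unfolding g_def by (metis (no_types, lifting))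
  qed
  have "infinite {n\<in>A. g n = z}" if "z \<in> Z" for z
  proof -
    have "C (e z) \<subseteq> {n\<in>A. g n = z}" using C(2) g_eq[OF that] by blast
    then show ?thesis using C(3) finite_subset by blast
  qed
  moreover have "g n \<in> Z" for n
  proof (cases "\<exists>z\<in>Z. n \<in> C (e z)")
    case True
    then show ?thesis using g_eq by blast
  qed (use z0 in \<open>simp add: g_def\<close>)
  ultimately show ?thesis by blast
qed simp

text \<open>The maps for the nodes strictly above \<open>x\<close> are copied to the pieces and
  glued. This is consistent because distinct pieces are almost disjoint, so a free ultrafilter
  contains at most one of them.\<close>

lemma interior_onto_cone_step:
  fixes P :: "'a set" and r :: "'a rel"
  assumes mad: "mad_family \<A>" and sep: "completely_separable \<A>"
    and P: "finite P" "refl_on P r" "trans r" and x: "x \<in> P"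
    and IH: "\<And>z. z \<in> P \<Longrightarrow> (x, z) \<in> r \<Longrightarrow> z \<noteq> x \<Longrightarrow> \<exists>f. interior_onto_cone P r z UNIV f"
  shows "\<exists>f. interior_onto_cone P r x UNIV f"
proof -
  define Z where "Z = {z\<in>P. (x, z) \<in> r \<and> z \<noteq> x}"
  have finZ: "finite Z" using P(1) by (simp add: Z_def)
  have ad: "ad_family \<A>" and infA: "infinite \<A>" using mad by (simp_all add: mad_family_def)
  have "\<forall>A\<in>\<A>. \<exists>g. (\<forall>z\<in>Z. infinite {n\<in>A. g n = z}) \<and> (Z \<noteq> {} \<longrightarrow> (\<forall>n. g n \<in> Z))"
    using ad finZ infinite_pieces by (auto simp: ad_family_def)
  then obtain g where g: "\<And>A z. A \<in> \<A> \<Longrightarrow> z \<in> Z \<Longrightarrow> infinite {n\<in>A. g A n = z}"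
    and gZ: "\<And>A n. A \<in> \<A> \<Longrightarrow> Z \<noteq> {} \<Longrightarrow> g A n \<in> Z"
    by metis
  define p where "p = (\<lambda>(A, z). {n\<in>A. g A n = z})"
  have "\<forall>i\<in>\<A>\<times>Z. \<exists>f. interior_onto_cone P r (snd i) (p i) f"
  proof
    fix i assume "i \<in> \<A>\<times>Z"
    then obtain A z where i: "i = (A, z)" "A \<in> \<A>" "z \<in> Z" by blast
    then obtain f where "interior_onto_cone P r z UNIV f" using IH by (auto simp: Z_def)
    then show "\<exists>f. interior_onto_cone P r (snd i) (p i) f"
      using interior_onto_cone_transfer[of P r z f "p i"] g i by (auto simp: p_def)
  qed
  then obtain F where F: "\<And>i. i \<in> \<A>\<times>Z \<Longrightarrow> interior_onto_cone P r (snd i) (p i) (F i)"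
    by metis
  \<comment> \<open>Two pieces of the same member are disjoint because their labels differ; pieces
    of different members inherit almost disjointness.\<close>
  have p_unique: "i = j"
    if "U \<in> free_ultrafilters UNIV" "i \<in> \<A>\<times>Z" "j \<in> \<A>\<times>Z" "p i \<in> U" "p j \<in> U" for U i j
  proof (rule ccontr)
    assume "i \<noteq> j"
    then have "finite (p i \<inter> p j)"
    proof (cases "fst i = fst j")
      case True
      then have "p i \<inter> p j = {}" using \<open>i \<noteq> j\<close> by (auto simp: p_def split_beta prod_eq_iff)
      then show ?thesis by simp
    next
      case False
      then have "finite (fst i \<inter> fst j)" 
        using ad that(2,3) unfolding ad_family_def by (metis SigmaE fst_conv)
      then show ?thesis by (rule rev_finite_subset) (auto simp: p_def split_beta)
    qed
    moreover have "p i \<inter> p j \<in> U"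
      using that ultrafilter_on_omegaD(4) by (auto simp: free_ultrafilters_def)
    ultimately show False using that(1) by (auto simp: free_ultrafilters_def)
  qed
  \<comment> \<open>On free ultrafilters the choice of \<open>i\<close> is forced by
    \<open>p_unique\<close>; those containing no piece get the default value
    \<open>x\<close>.\<close>
  define f where "f U = (if \<exists>i\<in>\<A>\<times>Z. p i \<in> U
      then let i = (SOME i. i \<in> \<A>\<times>Z \<and> p i \<in> U) in F i U else x)" for U
  have f_piece: "f U = F i U" if "U \<in> free_ultrafilters UNIV" "i \<in> \<A>\<times>Z" "p i \<in> U" for U i
  proof -
    have "(SOME i. i \<in> \<A>\<times>Z \<and> p i \<in> U) = i" using that p_unique by (intro some_equality) blast+
    then show ?thesis using that unfolding f_def Let_def by (metis (no_types, lifting))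
  qed
  have f_rest: "f U = x" if "\<And>i. i \<in> \<A>\<times>Z \<Longrightarrow> p i \<notin> U" for U
    using that unfolding f_def by (metis (no_types, lifting))
  have piece: "U \<in> free_ultrafilters (p i)" if "U \<in> free_ultrafilters UNIV" "p i \<in> U" for U i
    using that by (simp add: free_ultrafilters_def)
  have free: "U \<in> free_ultrafilters UNIV \<and> A \<in> U" if "U \<in> free_ultrafilters A" for U A
    using that by (auto simp: free_ultrafilters_def ultrafilter_on_omegaD(1))
  \<comment> \<open>A free ultrafilter meeting the ideal contains a member of the family. For
    nonempty \<open>Z\<close> that member is a finite union of pieces, so one piece belongs to the
    ultrafilter.\<close>
  have rest_notin_ideal: "B \<notin> ad_ideal \<A>"
    if U: "U \<in> free_ultrafilters UNIV" and no: "\<And>i. i \<in> \<A>\<times>Z \<Longrightarrow> p i \<notin> U"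
      and "Z \<noteq> {}" and "B \<in> U" for U B
  proof
    have uf: "ultrafilter_on_omega U" using U by (simp add: free_ultrafilters_def)
    assume "B \<in> ad_ideal \<A>"
    then obtain \<F> where \<F>: "\<F> \<subseteq> \<A>" "finite \<F>" "finite (B - \<Union>\<F>)" by (auto simp: ad_ideal_iff)
    then have "\<Union>\<F> \<in> U" using free_ultrafilters_almost_subset[OF U \<open>B \<in> U\<close>] by blast
    then obtain A where A: "A \<in> \<F>" "A \<in> U" using ultrafilter_on_omega_Union uf \<F>(2) by blast
    have "A = (\<Union>z\<in>Z. p (A, z))" using gZ[of A] A(1) \<F>(1) \<open>Z \<noteq> {}\<close> by (auto simp: p_def)
    then obtain z where "z \<in> Z" "p (A, z) \<in> U"
      using ultrafilter_on_omega_Union[OF uf, of "(\<lambda>z. p (A, z)) ` Z"] A(2) finZ by auto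
    then show False using no[of "(A, z)"] A(1) \<F>(1) by blast
  qed
  have cone: "f U \<in> P \<and> (x, f U) \<in> r" if U: "U \<in> free_ultrafilters UNIV" for U
  proof (cases "\<exists>i\<in>\<A>\<times>Z. p i \<in> U")
    case True
    then obtain i where i: "i \<in> \<A>\<times>Z" "p i \<in> U" by blast
    then have "F i U \<in> P" "(snd i, F i U) \<in> r" "(x, snd i) \<in> r"
      using interior_onto_coneD(1,2)[OF F[OF i(1)] piece[OF U i(2)]] by (auto simp: Z_def)
    then show ?thesis using f_piece[OF U i] P(3) by (auto dest: transD)
  next
    case False
    then show ?thesis using f_rest[of U] x P(2) by (auto simp: refl_on_def)
  qed
  have "interior_onto_cone P r x UNIV f"
    unfolding interior_onto_cone_def
  proof (intro conjI ballI impI)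
    fix U :: "nat set set" assume U: "U \<in> free_ultrafilters UNIV"
    then have uf: "ultrafilter_on_omega U" by (simp add: free_ultrafilters_def)
    show "f U \<in> P" "(x, f U) \<in> r" using cone[OF U] by auto
    show "\<exists>B\<in>U. \<forall>V\<in>free_ultrafilters UNIV. B \<in> V \<longrightarrow> (f U, f V) \<in> r"
    proof (cases "\<exists>i\<in>\<A>\<times>Z. p i \<in> U")
      case True
      then obtain i where i: "i \<in> \<A>\<times>Z" "p i \<in> U" by blast
      then obtain B where B: "B \<in> U"
        "\<forall>V\<in>free_ultrafilters (p i). B \<in> V \<longrightarrow> (F i U, F i V) \<in> r"
        using interior_onto_coneD(3)[OF F[OF i(1)] piece[OF U i(2)]] by blast
      show ?thesis
      proof (intro bexI ballI impI)
        show "B \<inter> p i \<in> U" using B(1) i(2) ultrafilter_on_omegaD(4)[OF uf] by blast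
        fix V assume V: "V \<in> free_ultrafilters UNIV" "B \<inter> p i \<in> V"
        then have "B \<in> V" "p i \<in> V"
          using ultrafilter_on_omegaD(3)[of V "B \<inter> p i"] by (auto simp: free_ultrafilters_def)
        then show "(f U, f V) \<in> r" using B(2) piece[OF V(1)] f_piece U V(1) i by metis
      qed
    next
      case False
      \<comment> \<open>Here \<open>f U = x\<close> lies below every value of \<open>f\<close>, so
        \<open>UNIV\<close> serves as the neighbourhood.\<close>
      then show ?thesis using f_rest[of U] cone ultrafilter_on_omegaD(1)[OF uf] by metis
    qed
    fix B y assume B: "B \<in> U" and y: "y \<in> P" "(f U, y) \<in> r"
    show "\<exists>V\<in>free_ultrafilters UNIV. B \<in> V \<and> f V = y"
    proof (cases "\<exists>i\<in>\<A>\<times>Z. p i \<in> U")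
      case True
      then obtain i where i: "i \<in> \<A>\<times>Z" "p i \<in> U" by blast
      then obtain V where V: "V \<in> free_ultrafilters (p i)" "B \<in> V" "F i V = y"
        using interior_onto_coneD(4)[OF F[OF i(1)] piece[OF U i(2)] B y(1)] y(2) f_piece[OF U i]
        by auto
      then show ?thesis using free[OF V(1)] f_piece[of V i] i(1) by blast
    next
      case False
      then have no: "\<And>i. i \<in> \<A>\<times>Z \<Longrightarrow> p i \<notin> U" by blast
      then have fU: "f U = x" by (rule f_rest)
      show ?thesis
      proof (cases "y = x")
        case True
        then show ?thesis using U B fU by blast
      next
        case False
        \<comment> \<open>Complete separability enters here: \<open>B\<close> almost contains a
          member \<open>A\<close>, hence its piece labelled \<open>y\<close>. An ultrafilter on that
          piece with value \<open>y\<close> therefore contains \<open>B\<close>.\<close>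
        then have yZ: "y \<in> Z" using y fU by (simp add: Z_def)
        then obtain A where A: "A \<in> \<A>" "finite (A - B)"
          using completely_separable_mad_almost_contains[OF mad sep] rest_notin_ideal[OF U no _ B]
          by blast
        then have i: "(A, y) \<in> \<A>\<times>Z" using yZ by blast
        obtain V where V: "V \<in> free_ultrafilters (p (A, y))" "F (A, y) V = y"
          using interior_onto_coneD(5)[OF F[OF i]] by auto
        have "finite (p (A, y) - B)" using A(2) by (rule rev_finite_subset) (auto simp: p_def)
        then have "B \<in> V" using free_ultrafilters_almost_subset[OF V(1)] free[OF V(1)] by blast
        then show ?thesis using V f_piece[OF _ i] free[OF V(1)] by auto
      qed
    qed
  next
    \<comment> \<open>An ultrafilter disjoint from the ideal is free and contains no piece, since
      pieces are subsets of members; so the value \<open>x\<close> is attained.\<close>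
    obtain U where U: "ultrafilter_on_omega U" "U \<inter> ad_ideal \<A> = {}"
      using ultrafilter_avoiding_ideal[OF set_ideal_ad_ideal UNIV_notin_ad_ideal[OF ad infA]] by blast
    have gen: "\<A> \<union> {F. finite F} \<subseteq> ad_ideal \<A>" unfolding ad_ideal_def by (rule hull_subset)
    then have "U \<in> free_ultrafilters UNIV"
      using U ultrafilter_on_omegaD(1)[OF U(1)] unfolding free_ultrafilters_def by blast
    moreover have "f U = x"
    proof (rule f_rest)
      fix i assume "i \<in> \<A>\<times>Z"
      then have "fst i \<in> ad_ideal \<A>" using gen by auto
      moreover have "p i \<subseteq> fst i" by (auto simp: p_def split_beta)
      ultimately have "p i \<in> ad_ideal \<A>" by (rule set_idealD(2)[OF set_ideal_ad_ideal])
      then show "p i \<notin> U" using U(2) by blast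
    qed
    ultimately show "\<exists>U\<in>free_ultrafilters UNIV. f U = x" by blast
  qed
  then show ?thesis by blast
qed

text \<open>Induction on the size of the cone above \<open>x\<close>: by antisymmetry, the cone of a
  strictly larger node omits \<open>x\<close>. At a maximal node there are no labels, and the map
  built is constant.\<close>

lemma interior_onto_cone_exists:
  fixes P :: "'a set" and r :: "'a rel"
  assumes "mad_family \<A>" "completely_separable \<A>"
    and P: "finite P" "refl_on P r" "trans r" "antisym r" and "x \<in> P"
  shows "\<exists>f. interior_onto_cone P r x UNIV f"
  using \<open>x \<in> P\<close>
proof (induction "card {y\<in>P. (x, y) \<in> r}" arbitrary: x rule: less_induct)
  case less
  show ?case
  proof (rule interior_onto_cone_step[OF assms(1,2) P(1-3) less.prems])
    fix z assume z: "z \<in> P" "(x, z) \<in> r" "z \<noteq> x"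
    then have "x \<notin> {y\<in>P. (z, y) \<in> r}" using P(4) by (auto dest: antisymD)
    moreover have "x \<in> {y\<in>P. (x, y) \<in> r}" using P(2) less.prems by (auto simp: refl_on_def)
    moreover have "{y\<in>P. (z, y) \<in> r} \<subseteq> {y\<in>P. (x, y) \<in> r}" using z P(3) by (auto dest: transD)
    ultimately have "{y\<in>P. (z, y) \<in> r} \<subset> {y\<in>P. (x, y) \<in> r}" by blast
    then have "card {y\<in>P. (z, y) \<in> r} < card {y\<in>P. (x, y) \<in> r}"
      using P(1) by (intro psubset_card_mono) auto
    then show "\<exists>f. interior_onto_cone P r z UNIV f" using less.hyps z(1) by blast
  qed
qed

section \<open>From the remainder to all of \<beta>\<omega>\<close>

lemma not_free_ultrafilter_contains_finite:
  assumes "ultrafilter_on_omega U" "U \<notin> free_ultrafilters UNIV"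
  shows "\<exists>F\<in>U. finite F"
  using assms ultrafilter_on_omegaD(1) by (auto simp: free_ultrafilters_def)

theorem theorem3p1:
  fixes T :: "'a set" and r :: "'a rel"
  assumes "\<exists>\<A>. mad_family \<A> \<and> completely_separable \<A>"
    and "tree_with_top T r"
  shows "\<exists>f. interior_map beta_omega (upset_topology T r) f \<and>
             f ` topspace beta_omega = topspace (upset_topology T r)"
proof -
  obtain \<A> where \<A>: "mad_family \<A>" "completely_separable \<A>" using assms(1) by blast
  obtain t where po: "partial_order_on T r" and t: "t \<in> T" "\<forall>x\<in>T. (x, t) \<in> r"
    and tree: "finite_tree (T - {t}) (Restr r (T - {t}))"
    using assms(2) unfolding tree_with_top_def by blast
  define P where "P = T - {t}"
  define q where "q = Restr r P"
  have q: "finite P" "refl_on P q" "trans q" "antisym q"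
    using tree by (auto simp: finite_tree_def partial_order_on_def preorder_on_def P_def q_def)
  obtain root where root: "root \<in> P" "\<forall>x\<in>P. (root, x) \<in> q"
    using tree by (auto simp: finite_tree_def P_def q_def)
  obtain f where f: "interior_onto_cone P q root UNIV f"
    using interior_onto_cone_exists[OF \<A> q root(1)] by blast
  \<comment> \<open>The cone above the root is all of \<open>P\<close>, so \<open>f\<close> covers
    the tree; the principal ultrafilters supply the added top \<open>t\<close>.\<close>
  define h where "h U = (if U \<in> free_ultrafilters UNIV then f U else t)" for U
  have t_max: "y = t" if "(t, y) \<in> r" "y \<in> T" for y
    using that t po by (auto simp: partial_order_on_def dest: antisymD)
  have hT: "h U \<in> T" for U
    using interior_onto_coneD(1)[OF f] t(1) by (auto simp: h_def P_def)
  have "continuous_map beta_omega (upset_topology T r) h"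
    unfolding continuous_map_def
  proof (intro conjI allI impI)
    show "h \<in> topspace beta_omega \<rightarrow> topspace (upset_topology T r)"
      using hT by (simp add: topspace_upset_topology)
  next
    fix W assume "openin (upset_topology T r) W"
    then have W: "\<And>x y. x \<in> W \<Longrightarrow> y \<in> T \<Longrightarrow> (x, y) \<in> r \<Longrightarrow> y \<in> W" "W \<subseteq> T"
      unfolding openin_upset_topology by blast+
    show "openin beta_omega {U \<in> topspace beta_omega. h U \<in> W}"
      unfolding openin_beta_omega_iff
    proof
      fix U assume "U \<in> {U \<in> topspace beta_omega. h U \<in> W}"
      then have U: "ultrafilter_on_omega U" "h U \<in> W" by (auto simp: topspace_beta_omega)
      \<comment> \<open>Every nonempty upward closed set contains the top, so principal ultrafilters
        in a neighbourhood never obstruct continuity.\<close>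
      then have tW: "t \<in> W" using W t by blast
      obtain B where B: "B \<in> U" "\<And>V. ultrafilter_on_omega V \<Longrightarrow> B \<in> V \<Longrightarrow> h V \<in> W"
      proof (cases "U \<in> free_ultrafilters UNIV")
        case True
        then obtain B where B: "B \<in> U" "\<forall>V\<in>free_ultrafilters UNIV. B \<in> V \<longrightarrow> (f U, f V) \<in> q"
          using interior_onto_coneD(3)[OF f] by blast
        have "h V \<in> W" if "B \<in> V" for V
        proof (cases "V \<in> free_ultrafilters UNIV")
          case True
          then have "(h U, h V) \<in> r"
            using B(2) that \<open>U \<in> free_ultrafilters UNIV\<close> by (auto simp: h_def q_def)
          then show ?thesis using W(1)[OF U(2) hT] by blast
        qed (use tW in \<open>simp add: h_def\<close>)
        then show ?thesis using that B(1) by blast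
      next
        case False
        \<comment> \<open>Every ultrafilter containing the finite set \<open>F\<close> is non-free
          and is sent to \<open>t\<close>, so \<open>hat F\<close> is the required
          neighbourhood.\<close>
        then obtain F where "F \<in> U" "finite F" using not_free_ultrafilter_contains_finite U(1) by blast
        then show ?thesis using that[of F] tW unfolding h_def free_ultrafilters_def
          by (metis (no_types, lifting) mem_Collect_eq)
      qed
      then show "\<exists>A. U \<in> hat A \<and> hat A \<subseteq> {U \<in> topspace beta_omega. h U \<in> W}"
        using U(1) by (intro exI[of _ B]) (auto simp: hat_def topspace_beta_omega)
    qed
  qed
  \<comment> \<open>Openness on basic sets: the image of \<open>hat A\<close> is upward closed. With
    \<open>A = UNIV\<close> this also yields surjectivity.\<close>
  moreover have lift: "\<exists>V. V \<in> hat A \<and> h V = y" 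
    if UA: "U \<in> hat A" and y: "y \<in> T" "(h U, y) \<in> r" for U A y
  proof (cases "y = t")
    case True
    \<comment> \<open>The top is attained at the principal ultrafilter of any \<open>n\<close> in
      \<open>A\<close>, which is not free because it contains \<open>{n}\<close>.\<close>
    have "A \<noteq> {}" using UA ultrafilter_on_omegaD(2)[of U] by (auto simp: hat_def)
    then obtain n where n: "n \<in> A" by blast
    have "h {A. n \<in> A} = t"
      by (auto simp: h_def free_ultrafilters_def dest: bspec[of _ _ "{n}"])
    then show ?thesis using n True ultrafilter_on_omega_principal[of n]
      by (intro exI[of _ "{A. n \<in> A}"]) (simp add: hat_def)
  next
    case False
    \<comment> \<open>Only \<open>t\<close> lies above \<open>t\<close>, so \<open>U\<close> must be
      free and the question reduces to openness of \<open>f\<close> inside the tree.\<close>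
    then have "h U \<noteq> t" using t_max y by auto
    then have U: "U \<in> free_ultrafilters UNIV" "A \<in> U" "h U = f U"
      using UA by (auto simp: h_def hat_def split: if_splits)
    have "(f U, y) \<in> q" "y \<in> P"
      using y False U interior_onto_coneD(1)[OF f U(1)] by (auto simp: q_def P_def)
    then obtain V where "V \<in> free_ultrafilters UNIV" "A \<in> V" "f V = y"
      using interior_onto_coneD(4)[OF f U(1,2)] by blast
    then show ?thesis by (intro exI[of _ V]) (auto simp: h_def hat_def free_ultrafilters_def)
  qed
  then have "open_map beta_omega (upset_topology T r) h"
    unfolding open_map_def openin_upset_topology openin_beta_omega_iff
    using hT by (blast intro: rev_image_eqI)
  moreover have "h ` topspace beta_omega = T"
  proof
    show "T \<subseteq> h ` topspace beta_omega"
    proof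
      fix y assume y: "y \<in> T"
      \<comment> \<open>Since the root is attained and lies below everything, \<open>lift\<close>
        reaches every node from \<open>U\<close>.\<close>
      obtain U where U: "U \<in> free_ultrafilters UNIV" "f U = root"
        using interior_onto_coneD(5)[OF f] by blast
      have "(root, y) \<in> r" using y root t by (cases "y = t") (auto simp: P_def q_def)
      then obtain V where "V \<in> hat UNIV" "h V = y"
        using lift[of U UNIV y] U y by (auto simp: hat_def h_def free_ultrafilters_def)
      then show "y \<in> h ` topspace beta_omega" by (auto simp: hat_def topspace_beta_omega)
    qed
  qed (use hT in auto)
  ultimately show ?thesis by (auto simp: interior_map_def topspace_upset_topology)
qed

end
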